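(* Let $q$ be a prime power, $n$ a positive integer coprime to $q$, $\gamma\in\mathbb{Z}/n\mathbb{Z}$ (viewed as an integer), $\tau=|c_{n/q}(\gamma)|$, and $\omega_\gamma$ as in the context. Then the leader of $c_{n/q}(\gamma)$ is $$\min\Big\{\gamma q^j \ (\mathrm{mod}\ \tfrac{\omega_\gamma n}{\tau}) : j=0,1,\dots,\omega_\gamma-1\Big\}.$$
   Context: $c_{n/q}(\gamma)=\{\gamma,\gamma q,\dots,\gamma q^{\tau-1}\}\subseteq\mathbb{Z}/n\mathbb{Z}$ with $\tau$ the least positive integer with $\gamma q^\tau\equiv\gamma\pmod n$. The leader of a coset is the smallest of its elements when each is represented by an integer in $\{0,1,\dots,n-1\}$. For integers $m$ and $N>0$, $m\ (\mathrm{mod}\ N)$ denotes the unique integer in $\{0,\dots,N-1\}$ congruent to $m$ modulo $N$. With $n_\gamma=n/\gcd(\gamma,n)$, $\mathrm{rad}(m)$ the product of the distinct primes dividing $m$ and $\mathrm{ord}_m(q)$ the order of $q$ modulo $m$: $\omega_\gamma=2\,\mathrm{ord}_{\mathrm{rad}(n_\gamma)}(q)$ if $q^{\mathrm{ord}_{\mathrm{rad}(n_\gamma)}(q)}\equiv3\pmod4$ and $8\mid n_\gamma$, and $\omega_\gamma=\mathrm{ord}_{\mathrm{rad}(n_\gamma)}(q)$ otherwise. *)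

theory Defs
  imports "HOL-Number_Theory.Number_Theory" "HOL-Number_Theory.Prime_Powers"
begin

text \<open>
  Residue classes modulo \<open>n\<close> are identified with their representatives in \<open>{0..<int n}\<close>;
  an element \<open>\<gamma>\<close> of the residue ring is given by an arbitrary integer representative.
\<close>

definition coset_period :: "nat \<Rightarrow> nat \<Rightarrow> int \<Rightarrow> nat" where
  "coset_period n q \<gamma> = (LEAST t. t > 0 \<and> [\<gamma> * int q ^ t = \<gamma>] (mod int n))"

definition cyclotomic_coset :: "nat \<Rightarrow> nat \<Rightarrow> int \<Rightarrow> int set" where
  "cyclotomic_coset n q \<gamma> = (\<lambda>i. (\<gamma> * int q ^ i) mod int n) ` {0..<coset_period n q \<gamma>}"

definition coset_leader :: "nat \<Rightarrow> nat \<Rightarrow> int \<Rightarrow> int" where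
  "coset_leader n q \<gamma> = Min (cyclotomic_coset n q \<gamma>)"

definition rad :: "nat \<Rightarrow> nat" where
  "rad m = \<Prod>(prime_factors m)"

definition n_red :: "nat \<Rightarrow> int \<Rightarrow> nat" where
  "n_red n \<gamma> = n div nat (gcd \<gamma> (int n))"

text \<open>
  The library's \<open>ord m q\<close> takes the modulus first; \<open>ord 1 q = 1\<close>, which covers \<open>n_red n \<gamma> = 1\<close>.
\<close>

definition omega :: "nat \<Rightarrow> nat \<Rightarrow> int \<Rightarrow> nat" where
  "omega n q \<gamma> =
    (let m = n_red n \<gamma>; d = ord (rad m) q in
      if [q ^ d = 3] (mod 4) \<and> 8 dvd m then 2 * d else d)"

end

theory Submission
  imports Defs
begin

text \<open>
  Put \<open>m = n / gcd(\<gamma>, n)\<close> and \<open>Q = q^\<omega>\<close>. Lifting the exponent gives \<open>m | Q^i - 1\<close> iff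
  \<open>m | i (Q - 1)\<close>, so the order \<open>s = \<tau> / \<omega>\<close> of \<open>Q\<close> modulo \<open>m\<close> divides \<open>m\<close>, and \<open>Q\<close> is \<open>1\<close> modulo
  \<open>m / s\<close>. Hence the \<open>s\<close> elements \<open>\<gamma> q^j Q^i\<close> of the coset all lie in the class of \<open>\<gamma> q^j\<close> modulo
  \<open>n / s\<close>; as that class has only \<open>s\<close> members in \<open>{0..<n}\<close>, the coset is a union of full classes
  modulo \<open>n / s = \<omega> n / \<tau>\<close>.
\<close>

section \<open>Geometric sums and lifting the exponent at one prime\<close>

text \<open>The binomial expansion cut off after its linear term. It is applied with
  \<open>p * t\<close> in place of \<open>t\<close>, to evaluate a geometric sum modulo the square
  of \<open>p\<close>.\<close>

lemma cong_power_linear: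
  fixes t :: int
  shows "[(1 + t) ^ k = 1 + int k * t] (mod t\<^sup>2)"
proof (induction k)
  case (Suc k)
  have "[(1 + t) * (1 + t) ^ k = (1 + t) * (1 + int k * t)] (mod t\<^sup>2)"
    using Suc by (rule cong_scalar_left)
  moreover have "(1 + t) * (1 + int k * t) = 1 + int (Suc k) * t + t\<^sup>2 * int k"
    by (simp add: algebra_simps power2_eq_square)
  moreover have "[1 + int (Suc k) * t + t\<^sup>2 * int k = 1 + int (Suc k) * t + 0] (mod t\<^sup>2)"
    by (intro cong_add cong_refl) (simp add: cong_0_iff)
  ultimately show ?case
    by (metis add.right_neutral cong_trans power_Suc)
qed simp

lemma cong_power_one:
  fixes a p :: int
  assumes "[a = 1] (mod p)"
  shows "[a ^ k = 1] (mod p)"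
  using cong_pow[OF assms, of k] by simp

lemma geometric_sum_cong:
  fixes a p :: int
  assumes "[a = 1] (mod p)"
  shows "[(\<Sum>k<i. a ^ k) = int i] (mod p)"
proof -
  have "[(\<Sum>k<i. a ^ k) = (\<Sum>k<i. 1)] (mod p)"
    by (intro cong_sum cong_power_one assms)
  then show ?thesis by simp
qed

text \<open>The quotient of \<open>a ^ p - 1\<close> by \<open>a - 1\<close> carries exactly one
  factor \<open>p\<close>, because it is congruent to \<open>p\<close> modulo the square of
  \<open>p\<close>. For \<open>p = 2\<close> this quotient is \<open>1 + a\<close>, which is why
  \<open>a\<close> has to be 1 modulo 4 there.\<close>

lemma geometric_sum_prime:
  fixes a :: int and p :: nat
  assumes p: "prime p" and a: "[a = 1] (mod int p)" and two: "p = 2 \<Longrightarrow> [a = 1] (mod 4)"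
  obtains u where "(\<Sum>k<p. a ^ k) = int p * u" "coprime (int p) u"
proof -
  obtain t where t: "a = 1 + int p * t"
    using a by (metis cong_iff_lin cong_sym)
  have "[(\<Sum>k<p. a ^ k) = int p] (mod (int p)\<^sup>2)"
  proof (cases "p = 2")
    case True
    have "(\<Sum>k<p. a ^ k) = 1 + a" by (simp add: True numeral_2_eq_2)
    moreover have "[1 + a = 1 + 1] (mod 4)" using two[OF True] by (intro cong_add cong_refl)
    ultimately show ?thesis by (simp add: True)
  next
    case False
    then have odd: "odd p" using p prime_odd_nat by (metis le_neq_implies_less prime_ge_2_nat)
    then obtain r where r: "p = 2 * r + 1" by (rule oddE)
    have "[(\<Sum>k<p. a ^ k) = (\<Sum>k<p. 1 + int k * (int p * t))] (mod (int p)\<^sup>2)"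
      unfolding t
      by (intro cong_sum cong_dvd_modulus[OF cong_power_linear]) (simp add: power_mult_distrib)
    moreover have "(\<Sum>k<p. 1 + int k * (int p * t)) = int p + (\<Sum>k<p. int k) * (int p * t)"
      by (simp add: sum.distrib sum_distrib_right)
    \<comment> \<open>As \<open>p\<close> is odd, \<open>(p - 1) / 2\<close> is the integer
      \<open>r\<close>; the sum thus supplies a second factor \<open>p\<close>, and the correction
      term vanishes modulo the square of \<open>p\<close>.\<close>
    moreover have "(\<Sum>k<p. int k) = int p * int r"
    proof -
      have "(\<Sum>k<2 * j + 1. int k) = int (2 * j + 1) * int j" for j
        by (induction j) (simp_all add: algebra_simps)
      then show ?thesis by (simp add: r)
    qed
    moreover have "[int p + int p * int r * (int p * t) = int p + 0] (mod (int p)\<^sup>2)"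
      by (intro cong_add cong_refl) (simp add: cong_0_iff power2_eq_square mult.left_commute)
    ultimately show ?thesis by (metis add.right_neutral cong_trans)
  qed
  then obtain v where v: "(\<Sum>k<p. a ^ k) = int p + (int p)\<^sup>2 * v"
    by (metis cong_iff_lin cong_sym)
  show thesis
  proof
    show "(\<Sum>k<p. a ^ k) = int p * (1 + int p * v)"
      by (simp add: v algebra_simps power2_eq_square)
    show "coprime (int p) (1 + int p * v)"
      by (metis coprime_1_right coprime_iff_gcd_eq_1 gcd_add_mult add.commute mult.commute)
  qed
qed

text \<open>Lifting the exponent, phrased without valuations: factors of \<open>p\<close> are moved from \<open>i\<close> into
  the base one at a time.\<close>

lemma prime_power_dvd_power_minus_1_iff:
  fixes a :: int and p :: nat
  assumes p: "prime p" and a: "[a = 1] (mod int p)" and two: "p = 2 \<Longrightarrow> [a = 1] (mod 4)"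
  shows "int p ^ e dvd a ^ i - 1 \<longleftrightarrow> int p ^ e dvd int i * (a - 1)"
  using a two
proof (induction i arbitrary: a rule: less_induct)
  case (less i)
  show ?case
  proof (cases "p dvd i")
    case False
    \<comment> \<open>Here \<open>(a ^ i - 1) / (a - 1)\<close> is congruent to \<open>i\<close>
      modulo \<open>p\<close>, so it is prime to \<open>p\<close>, as is \<open>i\<close>; both
      sides reduce to divisibility of \<open>a - 1\<close>.\<close>
    have "coprime (int p) (int i)"
      using False p by (simp add: prime_imp_coprime)
    moreover from this have "coprime (int p) (\<Sum>k<i. a ^ k)"
      using geometric_sum_cong[OF less.prems(1), of i]
      by (metis cong_imp_coprime cong_sym coprime_commute)
    ultimately have "coprime (int p ^ e) (\<Sum>k<i. a ^ k)" "coprime (int p ^ e) (int i)"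
      by simp_all
    then show ?thesis
      unfolding power_diff_1_eq by (simp add: coprime_dvd_mult_left_iff coprime_dvd_mult_right_iff)
  next
    case True
    then obtain j where j: "i = p * j" ..
    show ?thesis
    proof (cases "i = 0")
      case False
      then have lt: "j < i" using j p prime_gt_1_nat[OF p] by simp
      obtain u where u: "(\<Sum>k<p. a ^ k) = int p * u" "coprime (int p) u"
        using geometric_sum_prime[OF p less.prems] by blast
      \<comment> \<open>The induction hypothesis for base \<open>a ^ p\<close> and exponent
        \<open>j\<close>; passing to \<open>a ^ p\<close> preserves the congruences to 1. The factor
        \<open>p\<close> lost from \<open>i\<close> returns from \<open>a ^ p - 1\<close>, up to the
        factor \<open>u\<close> prime to \<open>p\<close>.\<close>
      have "int p ^ e dvd a ^ i - 1 \<longleftrightarrow> int p ^ e dvd int j * (a ^ p - 1)"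
        using less.IH[OF lt, of "a ^ p"] less.prems
        by (simp add: j power_mult cong_power_one)
      also have "int j * (a ^ p - 1) = (int i * (a - 1)) * u"
        unfolding power_diff_1_eq u by (simp add: j)
      also have "int p ^ e dvd \<dots> \<longleftrightarrow> int p ^ e dvd int i * (a - 1)"
        using u(2) by (simp add: coprime_dvd_mult_left_iff)
      finally show ?thesis .
    qed simp
  qed
qed

section \<open>Composite moduli and the order of a base congruent to 1\<close>

lemma dvd_iff_prime_powers_dvd:
  fixes m :: nat and x :: int
  assumes "m > 0"
  shows "int m dvd x \<longleftrightarrow> (\<forall>p. prime p \<longrightarrow> int p ^ multiplicity p m dvd x)"
proof -
  have "int m dvd x \<longleftrightarrow> m dvd nat \<bar>x\<bar>"
    by (simp add: nat_abs_dvd_iff)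
  moreover have "int p ^ e dvd x \<longleftrightarrow> p ^ e dvd nat \<bar>x\<bar>" for p e :: nat
    by (metis int_dvd_int_iff dvd_nat_abs_iff of_nat_power)
  moreover have "m dvd y \<longleftrightarrow> (\<forall>p. prime p \<longrightarrow> p ^ multiplicity p m dvd y)" for y :: nat
  proof
    show "\<forall>p. prime p \<longrightarrow> p ^ multiplicity p m dvd y" if "m dvd y"
      using dvd_trans[OF multiplicity_dvd that] by blast
    show "m dvd y" if y: "\<forall>p. prime p \<longrightarrow> p ^ multiplicity p m dvd y"
    proof (cases "y = 0")
      case False
      show ?thesis
      proof (rule multiplicity_le_imp_dvd)
        show "multiplicity p m \<le> multiplicity p y" if "prime p" for p
          using y that False not_prime_unit by (intro multiplicity_geI) auto
      qed (use assms in simp)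
    qed simp
  qed
  ultimately show ?thesis by (simp only:)
qed

text \<open>The claim is local at each prime. Lifting the exponent settles all cases but
  \<open>p = 2\<close> with \<open>a\<close> congruent to 3 modulo 4; then 8 does not divide
  \<open>m\<close>, and only the 2-parts 2 and 4 remain, where the equivalence still holds.\<close>

lemma dvd_power_minus_1_iff:
  fixes a :: int and m :: nat
  assumes m: "m > 0" and primes: "\<And>p. prime p \<Longrightarrow> p dvd m \<Longrightarrow> [a = 1] (mod int p)"
    and eight: "8 dvd m \<Longrightarrow> [a = 1] (mod 4)"
  shows "int m dvd a ^ i - 1 \<longleftrightarrow> int m dvd int i * (a - 1)"
proof -
  have "int p ^ multiplicity p m dvd a ^ i - 1 \<longleftrightarrow> int p ^ multiplicity p m dvd int i * (a - 1)"
    if p: "prime p" for p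
  proof (cases "p dvd m")
    case False
    then show ?thesis by (simp add: not_dvd_imp_multiplicity_0)
  next
    case True
    note a = primes[OF p True]
    show ?thesis
    proof (cases "p = 2 \<and> \<not> [a = 1] (mod 4)")
      case False
      then show ?thesis using prime_power_dvd_power_minus_1_iff[OF p a] by blast
    next
      case two: True
      with a have "odd a" by (simp add: cong_iff_dvd_diff)
      with two have a3: "a mod 4 = 3"
        unfolding cong_def by presburger
      have "\<not> 2 ^ 3 dvd m" using two eight by auto
      then have "multiplicity p m < 3" using two
        by (metis multiplicity_dvd' not_le)
      moreover have "int 2 ^ 1 dvd a ^ i - 1 \<longleftrightarrow> int 2 ^ 1 dvd int i * (a - 1)"
        using \<open>odd a\<close> by simp
      \<comment> \<open>With \<open>a\<close> congruent to 3 modulo 4, both divisibilities by 4 hold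
        for even \<open>i\<close> and fail for odd \<open>i\<close>.\<close>
      moreover have "int 2 ^ 2 dvd a ^ i - 1 \<longleftrightarrow> int 2 ^ 2 dvd int i * (a - 1)"
      proof -
        have sq: "[a ^ 2 = 1] (mod 4)"
          using cong_pow[of a 3 4 2] a3 by (simp add: cong_def)
        show ?thesis
        proof (cases "even i")
          case True
          then obtain j where j: "i = 2 * j" ..
          have "[a ^ i = 1] (mod 4)" unfolding j power_mult by (rule cong_power_one[OF sq])
          moreover have "2 * 2 dvd int i * (a - 1)"
            using \<open>odd a\<close> True by (intro mult_dvd_mono) auto
          ultimately show ?thesis by (simp add: cong_iff_dvd_diff)
        next
          case False
          then obtain j where j: "i = 2 * j + 1" by (rule oddE)
          have "[a ^ i = 1 * 3] (mod 4)" unfolding j power_add power_mult power_one_right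
            using a3 by (intro cong_mult cong_power_one[OF sq]) (simp add: cong_def)
          then have "\<not> 4 dvd a ^ i - 1" unfolding cong_def by presburger
          moreover have "\<not> 4 dvd int i * (a - 1)"
          proof
            have "coprime 4 (int i)" using False coprime_power_left_iff[of 2 2 "int i"]
              by (simp add: coprime_left_2_iff_odd)
            moreover assume "4 dvd int i * (a - 1)"
            ultimately have "4 dvd a - 1" by (simp add: coprime_dvd_mult_right_iff)
            then show False using a3 by presburger
          qed
          ultimately show ?thesis by simp
        qed
      qed
      ultimately show ?thesis using two
        by (auto simp: less_Suc_eq numeral_3_eq_3 numeral_2_eq_2)
    qed
  qed
  then show ?thesis using m by (simp add: dvd_iff_prime_powers_dvd)
qed

text \<open>Both claims instantiate the linear criterion for \<open>a ^ i\<close> to be 1 modulo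
  \<open>m\<close>: \<open>i = m\<close> gives the first, and \<open>i = ord m a\<close> gives the
  second after cancelling the order.\<close>

lemma ord_dvd_modulus:
  fixes m a :: nat
  assumes m: "m > 0" and primes: "\<And>p. prime p \<Longrightarrow> p dvd m \<Longrightarrow> [a = 1] (mod p)"
    and eight: "8 dvd m \<Longrightarrow> [a = 1] (mod 4)"
  shows "ord m a dvd m" and "[a = 1] (mod (m div ord m a))"
proof -
  have iff: "ord m a dvd i \<longleftrightarrow> int m dvd int i * (int a - 1)" for i
  proof -
    have "ord m a dvd i \<longleftrightarrow> [int a ^ i = 1] (mod int m)"
      unfolding ord_divides[symmetric] by (metis cong_int_iff of_nat_1 of_nat_power)
    also have "\<dots> \<longleftrightarrow> int m dvd int a ^ i - 1" by (rule cong_iff_dvd_diff)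
    also have "\<dots> \<longleftrightarrow> int m dvd int i * (int a - 1)"
      using primes eight cong_int_iff[of a 1] cong_int_iff[of a 1 4]
      by (intro dvd_power_minus_1_iff m) auto
    finally show ?thesis .
  qed
  show dvd: "ord m a dvd m" using iff by simp
  then obtain k where k: "m = ord m a * k" ..
  with m have "ord m a > 0" by (metis gr0I mult_0 less_irrefl)
  have "int m dvd int (ord m a) * (int a - 1)" using iff[of "ord m a"] by simp
  then have "int (ord m a) * int k dvd int (ord m a) * (int a - 1)"
    using k by (metis of_nat_mult)
  then have "int k dvd int a - 1" using \<open>ord m a > 0\<close> by simp
  then have "[int a = int 1] (mod int k)" by (simp add: cong_iff_dvd_diff)
  moreover have "m div ord m a = k" using k \<open>ord m a > 0\<close> by (metis nonzero_mult_div_cancel_left less_irrefl)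
  ultimately show "[a = 1] (mod (m div ord m a))" by (simp only: cong_int_iff)
qed

section \<open>The reduced modulus and the structure of cosets\<close>

lemma prime_dvd_rad: "prime p \<Longrightarrow> p dvd m \<Longrightarrow> m > 0 \<Longrightarrow> p dvd rad m"
  unfolding rad_def by (intro dvd_prodI) (auto simp: in_prime_factors_iff)

lemma rad_dvd:
  assumes "m > 0"
  shows "rad m dvd m"
proof -
  have "rad m dvd (\<Prod>p\<in>prime_factors m. p ^ multiplicity p m)"
    unfolding rad_def by (intro prod_dvd_prod) (simp add: prime_factors_multiplicity)
  also have "\<dots> = m" using assms by (simp add: prod_prime_factors)
  finally show ?thesis .
qed

lemma n_red_props:
  assumes n: "n > 0"
  shows "n_red n \<gamma> > 0" and "int n = gcd \<gamma> (int n) * int (n_red n \<gamma>)"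
proof -
  show *: "int n = gcd \<gamma> (int n) * int (n_red n \<gamma>)"
    by (simp add: n_red_def zdiv_int)
  then show "n_red n \<gamma> > 0" using n by (metis gr0I mult_zero_right of_nat_0 of_nat_eq_0_iff)
qed

lemma coprime_n_red:
  assumes n: "n > 0" and cop: "coprime n q"
  shows "coprime (n_red n \<gamma>) q"
  using cop n_red_props(2)[OF n, of \<gamma>] by (metis coprime_mult_left_iff coprime_int_iff)

text \<open>Dividing \<gamma> and \<open>n\<close> by their gcd leaves a unit modulo
  \<open>n_red n \<gamma>\<close>, which cancels; what remains compares powers of \<open>q\<close>
  modulo \<open>n_red n \<gamma>\<close>.\<close>

lemma cong_mult_power_iff:
  assumes n: "n > 0" and cop: "coprime n q"
  shows "[\<gamma> * int q ^ a = \<gamma> * int q ^ b] (mod int n) \<longleftrightarrow> [a = b] (mod ord (n_red n \<gamma>) q)"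
proof -
  let ?m = "int (n_red n \<gamma>)"
  define g where "g = gcd \<gamma> (int n)"
  have g: "g > 0" using n by (simp add: g_def)
  have n_eq: "int n = g * ?m" using n_red_props(2)[OF n] by (simp add: g_def)
  obtain c where c: "\<gamma> = g * c" unfolding g_def by (metis dvdE gcd_dvd1)
  have "int n div g = ?m" "\<gamma> div g = c" using g by (simp_all add: n_eq c)
  moreover have "coprime (\<gamma> div g) (int n div g)"
    unfolding g_def by (rule div_gcd_coprime) (use n in simp)
  ultimately have "coprime c ?m" by simp
  then have "[c * int q ^ a = c * int q ^ b] (mod ?m) \<longleftrightarrow> [int (q ^ a) = int (q ^ b)] (mod ?m)"
    by (simp add: cong_mult_lcancel)
  moreover have "[\<gamma> * int q ^ a = \<gamma> * int q ^ b] (mod int n) \<longleftrightarrow>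
      [c * int q ^ a = c * int q ^ b] (mod ?m)"
    unfolding cong_iff_dvd_diff n_eq c using g
    by (simp add: mult.assoc flip: right_diff_distrib)
  ultimately show ?thesis
    using order_divides_expdiff[OF coprime_n_red[OF n cop]] by (simp only: cong_int_iff)
qed

lemma coset_period_eq_ord:
  assumes n: "n > 0" and cop: "coprime n q"
  shows "coset_period n q \<gamma> = ord (n_red n \<gamma>) q"
proof -
  have "[\<gamma> * int q ^ t = \<gamma>] (mod int n) \<longleftrightarrow> ord (n_red n \<gamma>) q dvd t" for t
    using cong_mult_power_iff[OF n cop, of \<gamma> t 0] by (simp add: cong_0_iff)
  then show ?thesis
    unfolding coset_period_def using coprime_n_red[OF n cop]
    by (intro Least_equality) (auto intro: dvd_imp_le)
qed

text \<open>Residues agree exactly when exponents agree modulo the order. The description as a range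
  allows arbitrary exponents in membership proofs.\<close>

lemma cyclotomic_coset_altdef:
  assumes n: "n > 0" and cop: "coprime n q"
  shows "card (cyclotomic_coset n q \<gamma>) = ord (n_red n \<gamma>) q"
    and "cyclotomic_coset n q \<gamma> = range (\<lambda>i. (\<gamma> * int q ^ i) mod int n)"
proof -
  let ?t = "ord (n_red n \<gamma>) q"
  have eq: "(\<gamma> * int q ^ a) mod int n = (\<gamma> * int q ^ b) mod int n \<longleftrightarrow> a mod ?t = b mod ?t" for a b
    using cong_mult_power_iff[OF n cop] unfolding cong_def .
  have t: "?t > 0"
    using coprime_n_red[OF n cop] by simp
  note def = cyclotomic_coset_def coset_period_eq_ord[OF n cop]
  show "card (cyclotomic_coset n q \<gamma>) = ?t"
    unfolding def by (subst card_image) (auto simp: inj_on_def eq)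
  show "cyclotomic_coset n q \<gamma> = range (\<lambda>i. (\<gamma> * int q ^ i) mod int n)"
  proof
    show "range (\<lambda>i. (\<gamma> * int q ^ i) mod int n) \<subseteq> cyclotomic_coset n q \<gamma>"
    proof clarify
      fix i
      have "(\<gamma> * int q ^ i) mod int n = (\<gamma> * int q ^ (i mod ?t)) mod int n" by (simp add: eq)
      then show "(\<gamma> * int q ^ i) mod int n \<in> cyclotomic_coset n q \<gamma>"
        unfolding def using t by auto
    qed
  qed (auto simp: def)
qed

text \<open>The factor 2 in \<open>omega\<close> is exactly what turns \<open>3\<close> into \<open>1\<close> modulo \<open>4\<close>, as lifting the
  exponent at the prime 2 requires.\<close>

lemma omega_dvd_ord:
  fixes n q :: nat and \<gamma> :: int
  defines "m \<equiv> n_red n \<gamma>" and "w \<equiv> omega n q \<gamma>"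
  assumes n: "n > 0" and cop: "coprime n q"
  shows "w dvd ord m q" and "w > 0"
    and "\<And>p. prime p \<Longrightarrow> p dvd m \<Longrightarrow> [q ^ w = 1] (mod p)"
    and "8 dvd m \<Longrightarrow> [q ^ w = 1] (mod 4)"
proof -
  define d where "d = ord (rad m) q"
  have m: "m > 0" using n_red_props(1)[OF n] by (simp add: m_def)
  have cop_m: "coprime m q"
    using coprime_n_red[OF n cop] by (simp add: m_def)
  have w: "w = (if [q ^ d = 3] (mod 4) \<and> 8 dvd m then 2 * d else d)"
    by (simp add: w_def omega_def Let_def m_def d_def)
  have "coprime (rad m) q" using coprime_divisors[OF rad_dvd[OF m] dvd_refl cop_m] .
  then show "w > 0" by (simp add: w d_def)
  have "[q ^ ord m q = 1] (mod rad m)" using cong_dvd_modulus_nat[OF ord rad_dvd[OF m]] .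
  then have d_dvd: "d dvd ord m q" unfolding d_def ord_divides .
  have d_dvd_w: "d dvd w" by (simp add: w)
  show "[q ^ w = 1] (mod p)" if "prime p" "p dvd m" for p
  proof -
    have "[q ^ w = 1] (mod rad m)" using d_dvd_w unfolding d_def ord_divides .
    then show ?thesis using prime_dvd_rad[OF that m] by (rule cong_dvd_modulus_nat)
  qed
  have odd: "odd (q ^ d)" if "8 dvd m"
  proof -
    have "2 dvd m" using that by (auto intro: dvd_trans[of _ 8])
    then have "coprime 2 q" using coprime_divisors[OF _ dvd_refl cop_m] by blast
    then show ?thesis by simp
  qed
  have sq: "[(q ^ d)\<^sup>2 = 1] (mod 4)" if "8 dvd m"
    using square_mod_8_eq_1_iff[of "q ^ d"] odd[OF that] by (auto intro: cong_dvd_modulus_nat)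
  show "[q ^ w = 1] (mod 4)" if "8 dvd m"
  proof (cases "[q ^ d = 3] (mod 4)")
    case True
    then show ?thesis using that sq by (simp add: w power_mult mult.commute[of 2])
  next
    case False
    have "[x = 1] (mod 4)" if "odd x" "\<not> [x = 3] (mod 4)" for x :: nat
    proof -
      have "x mod 4 \<noteq> 3" using \<open>\<not> [x = 3] (mod 4)\<close> by (simp add: cong_def)
      with \<open>odd x\<close> have "x mod 4 = 1" by presburger
      then show ?thesis by (simp add: cong_def)
    qed
    then have "[q ^ d = 1] (mod 4)" using odd[OF that] False .
    then show ?thesis using False by (simp add: w)
  qed
  show "w dvd ord m q"
  proof (cases "[q ^ d = 3] (mod 4) \<and> 8 dvd m")
    case True
    obtain k where k: "ord m q = d * k" using d_dvd ..
    \<comment> \<open>For odd \<open>k\<close>, the power \<open>q ^ ord m q\<close> would be 3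
      modulo 4, although it is 1 modulo \<open>m\<close> and 4 divides \<open>m\<close>.\<close>
    have "even k"
    proof (rule ccontr)
      assume "odd k"
      then obtain j where j: "k = 2 * j + 1" by (rule oddE)
      have "q ^ ord m q = ((q ^ d)\<^sup>2) ^ j * q ^ d"
        unfolding k j power_mult power_add by simp
      moreover have "[((q ^ d)\<^sup>2) ^ j * q ^ d = 1 ^ j * 3] (mod 4)"
        using True by (intro cong_mult cong_pow sq) blast+
      moreover have "[q ^ ord m q = 1] (mod 4)"
        using True by (intro cong_dvd_modulus_nat[OF ord]) (auto intro: dvd_trans[of _ 8])
      ultimately show False by (simp add: cong_def)
    qed
    then show ?thesis using True k by (auto simp: w)
  qed (use d_dvd in \<open>auto simp: w\<close>)
qed

section \<open>The coset leader as a minimum of smaller residues\<close>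

theorem theorem6p1:
  fixes q n \<tau> \<omega> :: nat and \<gamma> :: int
  assumes "primepow q" and "n > 0" and "coprime n q"
    and "\<tau> = card (cyclotomic_coset n q \<gamma>)"
    and "\<omega> = omega n q \<gamma>"
  shows "\<tau> dvd \<omega> * n \<and>
    coset_leader n q \<gamma> =
      Min ((\<lambda>j. (\<gamma> * int q ^ j) mod int (\<omega> * n div \<tau>)) ` {0..<\<omega>})"
proof -
  note n = assms(2) and cop = assms(3)
  define m where "m = n_red n \<gamma>"
  define s where "s = ord m (q ^ \<omega>)"
  have \<tau>: "\<tau> = ord m q"
    using assms(4) cyclotomic_coset_altdef(1)[OF n cop] by (simp add: m_def)
  have m: "m > 0" and n_eq: "int n = gcd \<gamma> (int n) * int m"
    using n_red_props[OF n] by (simp_all add: m_def)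
  have cop_m: "coprime m q"
    using coprime_n_red[OF n cop] by (simp add: m_def)
  note omega = omega_dvd_ord[OF n cop, where \<gamma> = \<gamma>, folded m_def assms(5)]
  have \<tau>_eq: "\<tau> = \<omega> * s"
    using omega(1) ord_power[OF cop_m, of \<omega>] by (simp add: s_def \<tau> gcd_nat.absorb1)
  have s: "s dvd m" and Q: "[q ^ \<omega> = 1] (mod (m div s))"
    using ord_dvd_modulus[OF m, of "q ^ \<omega>"] omega(3,4) by (simp_all add: s_def)
  have s_pos: "s > 0" using s m by (metis dvd_0_left gr0I less_irrefl)
  have "m dvd n" using n_eq by (metis dvd_triv_right int_dvd_int_iff)
  with s obtain N where N: "n = s * N" by (meson dvdE dvd_trans)
  have N_pos: "N > 0" using N n by (metis gr0I mult_0_right less_irrefl)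
  have wn: "\<omega> * n = \<tau> * N" by (simp add: \<tau>_eq N)
  have \<tau>_pos: "\<tau> > 0" using \<tau>_eq s_pos omega(2) by simp
  have div: "\<omega> * n div \<tau> = N" using wn \<tau>_pos by simp
  have N_eq: "int N = gcd \<gamma> (int n) * int (m div s)"
  proof -
    have "int s * int N = int s * (gcd \<gamma> (int n) * int (m div s))"
      using n_eq N s by (metis dvd_mult_div_cancel mult.left_commute of_nat_mult)
    then show ?thesis using s_pos by simp
  qed
  have step: "[\<gamma> * int q ^ (j + \<omega> * i) = \<gamma> * int q ^ j] (mod int N)" for i j
  proof -
    have "[(q ^ \<omega>) ^ i = 1 ^ i] (mod (m div s))" using Q by (rule cong_pow)
    then have "[int q ^ (\<omega> * i) = 1] (mod int (m div s))"
      by (metis cong_int_iff of_nat_1 of_nat_power power_mult power_one)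
    then have "int (m div s) dvd int q ^ (\<omega> * i) - 1" by (simp add: cong_iff_dvd_diff)
    then have "int N dvd \<gamma> * (int q ^ (\<omega> * i) - 1)"
      unfolding N_eq by (intro mult_dvd_mono) auto
    then have "int N dvd (\<gamma> * (int q ^ (\<omega> * i) - 1)) * int q ^ j" by (rule dvd_mult2)
    then show ?thesis by (simp add: cong_iff_dvd_diff algebra_simps power_add)
  qed
  let ?A = "cyclotomic_coset n q \<gamma>"
  let ?B = "(\<lambda>j. (\<gamma> * int q ^ j) mod int N) ` {0..<\<omega>}"
  note A = cyclotomic_coset_altdef(2)[OF n cop, of \<gamma>]
  \<comment> \<open>Reducing a coset element modulo \<open>N\<close> does not increase it, and by
    \<open>step\<close> its exponent can then be reduced modulo \<omega>.\<close>
  have lower: "\<exists>b\<in>?B. b \<le> x" if "x \<in> ?A" for x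
  proof -
    obtain i where x: "x = (\<gamma> * int q ^ i) mod int n" using \<open>x \<in> ?A\<close> unfolding A by auto
    have "x mod int N = (\<gamma> * int q ^ i) mod int N"
      unfolding x by (rule mod_mod_cancel) (simp add: N)
    also have "\<dots> = (\<gamma> * int q ^ (i mod \<omega>)) mod int N"
      using step[of "i mod \<omega>" "i div \<omega>"] by (simp add: cong_def)
    finally have "x mod int N \<in> ?B" using omega(2) by auto
    moreover have "x mod int N \<le> x" using n by (intro zmod_le_nonneg_dividend) (simp add: x)
    ultimately show ?thesis by blast
  qed
  have "?B \<subseteq> ?A"
  proof clarify
    fix j assume j: "j \<in> {0..<\<omega>}"
    define r where "r = (\<gamma> * int q ^ j) mod int N"
    \<comment> \<open>\<open>T\<close> lists the representatives in \<open>{0..<int n}\<close> of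
      the class of \<open>r\<close> modulo \<open>N\<close>; there are \<open>s\<close> of them
      since \<open>n = s * N\<close>.\<close>
    define T where "T = (\<lambda>k. r + int N * int k) ` {0..<s}"
    define f where "f i = (\<gamma> * int q ^ (j + \<omega> * i)) mod int n" for i
    have "f i \<in> T" for i
    proof -
      have "f i mod int N = (\<gamma> * int q ^ (j + \<omega> * i)) mod int N"
        unfolding f_def by (rule mod_mod_cancel) (simp add: N)
      then have "f i mod int N = r" using step[of j i] by (simp add: cong_def r_def)
      then have "f i = r + int N * (f i div int N)" by (metis mod_mult_div_eq)
      moreover have "0 \<le> f i" "f i < int N * int s"
        using n pos_mod_bound[of "int n"] by (simp_all add: f_def N mult.commute)
      then have "int N * (f i div int N) < int N * int s"
        using N_pos pos_mod_sign[of "int N" "f i"] mult_div_mod_eq[of "int N" "f i"] by linarith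
      then have "f i div int N < int s" using N_pos by simp
      moreover have "0 \<le> f i div int N"
        using N_pos \<open>0 \<le> f i\<close> by (simp add: pos_imp_zdiv_nonneg_iff)
      ultimately show ?thesis
        unfolding T_def by (intro image_eqI[of _ _ "nat (f i div int N)"]) auto
    qed
    \<comment> \<open>The exponents \<open>j + \<omega> * k\<close> with \<open>k < s\<close> are
      distinct and below \<tau>, hence distinct modulo the period.\<close>
    moreover have "inj_on f {0..<s}"
    proof (rule inj_onI)
      fix a b assume ab: "a \<in> {0..<s}" "b \<in> {0..<s}" and "f a = f b"
      then have "[j + \<omega> * a = j + \<omega> * b] (mod \<tau>)"
        using cong_mult_power_iff[OF n cop] unfolding f_def \<tau> m_def cong_def by blast
      moreover have "j + \<omega> * k < \<tau>" if "k < s" for k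
      proof -
        have "j + \<omega> * k < \<omega> * Suc k" using j by simp
        also have "\<dots> \<le> \<tau>" unfolding \<tau>_eq using that by (intro mult_le_mono2) simp
        finally show ?thesis .
      qed
      ultimately show "a = b" using ab omega(2) by (simp add: cong_def)
    qed
    moreover have "card T \<le> s" unfolding T_def
      by (metis card_atLeastLessThan card_image_le diff_zero finite_atLeastLessThan)
    \<comment> \<open>An injection from \<open>s\<close> indices into at most \<open>s\<close>
      values is onto, so the whole class lies in the coset, in particular its least member
      \<open>r\<close>.\<close>
    ultimately have "f ` {0..<s} = T"
      by (intro card_seteq) (auto simp: T_def card_image)
    moreover have "r \<in> T" unfolding T_def using s_pos by force
    ultimately have "r \<in> f ` {0..<s}" by simp
    then show "(\<gamma> * int q ^ j) mod int N \<in> ?A" unfolding A f_def r_def by auto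
  qed
  moreover have "finite ?A" by (simp add: cyclotomic_coset_def)
  moreover have "?B \<noteq> {}" using omega(2) by simp
  \<comment> \<open>The inclusion of \<open>?B\<close> in \<open>?A\<close> gives one inequality,
    and \<open>lower\<close> applied to \<open>Min ?A\<close> gives the other.\<close>
  ultimately have "Min ?A = Min ?B"
  proof (intro antisym)
    have "\<exists>b\<in>?B. b \<le> Min ?A"
      using \<open>?B \<subseteq> ?A\<close> \<open>finite ?A\<close> \<open>?B \<noteq> {}\<close> by (intro lower Min_in) auto
    then show "Min ?B \<le> Min ?A" by (subst Min_le_iff) (use omega(2) in auto)
  qed (rule Min_antimono)
  then show ?thesis
    unfolding coset_leader_def div using wn by simp
qed

end
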